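(* Consider a sequence of connected undirected graphs $\mathcal{G}_n$, $n\in\mathbb{Z}_+$, where $\mathcal{G}_n$ has $n$ nodes, and an associated sequence of sets of grounded nodes $S_n$, where $S_n$ is a nonempty subset of the nodes of $\mathcal{G}_n$. Let $\bar{L}_n$ denote the Laplacian matrix of the subgraph of $\mathcal{G}_n$ induced by the non-grounded nodes, this subgraph being connected with at least two nodes (for all sufficiently large $n$), and let $\lambda_n$ denote the smallest eigenvalue of the grounded Laplacian of $\mathcal{G}_n$ with grounded set $S_n$. Then: 1. If $\displaystyle\limsup_{n\to\infty}\frac{2\sqrt{|S_n|\,|\partial S_n|}}{\lambda_2(\bar{L}_n)}<1$, then $\displaystyle\lambda_n=\Theta\!\left(\frac{|\partial S_n|}{n-|S_n|}\right)$. 2. If $\displaystyle\lim_{n\to\infty}\frac{\sqrt{|S_n|\,|\partial S_n|}}{\lambda_2(\bar{L}_n)}=0$, then $\displaystyle(1-o(1))\frac{|\partial S_n|}{n-|S_n|}\le\lambda_n\le\frac{|\partial S_n|}{n-|S_n|}$.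
   Context: Graphs are finite, simple and undirected. The Laplacian of a graph is $L=D-A$ (degree matrix minus adjacency matrix). The grounded Laplacian of a graph with grounded set $S$ is the matrix obtained from $L$ by removing the rows and columns corresponding to the nodes in $S$. $\partial S$ is the set of edges with one endpoint in $S$ and the other outside $S$. $\lambda_2(\cdot)$ denotes the second smallest eigenvalue (counted with multiplicity). The matrix $\bar{L}_n$ is the Laplacian of the graph obtained from $\mathcal{G}_n$ by deleting the nodes in $S_n$ and all their incident edges. Asymptotic notation is as $n\to\infty$: $f_n=\Theta(g_n)$ means there are constants $c_1,c_2>0$ with $c_1g_n\le f_n\le c_2g_n$ for all sufficiently large $n$; $o(1)$ denotes a sequence tending to $0$, and the inequalities in part 2 are understood for all sufficiently large $n$. *)

theory Defs
  imports
    Complex_Main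
    "HOL-Library.Extended_Real"
    "HOL-Library.Liminf_Limsup"
    "HOL-Computational_Algebra.Polynomial"
    "Jordan_Normal_Form.Char_Poly"
    "Jordan_Normal_Form.DL_Submatrix"
    "Jordan_Normal_Form.Spectral_Radius"
    "Graph_Theory.Digraph"
    "Graph_Theory.Digraph_Component"
begin

text \<open>
  Finite simple undirected graphs are the instances of the locale \<open>graph\<close>: finite digraphs without
  loops and parallel arcs whose adjacency relation is symmetric. An undirected edge \<open>{u, v}\<close> is
  thus represented by the two arcs from \<open>u\<close> to \<open>v\<close> and from \<open>v\<close> to \<open>u\<close>, and the degree of a vertex
  is its out-degree.

  Rows and columns of the matrices below are indexed by the vertices in increasing order.
\<close>

definition vertex_at :: "('a::linorder, 'b) pre_digraph \<Rightarrow> nat \<Rightarrow> 'a" where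
  "vertex_at G i = sorted_list_of_set (verts G) ! i"

definition adjacency_matrix :: "('a::linorder, 'b) pre_digraph \<Rightarrow> real mat" where
  "adjacency_matrix G = mat (card (verts G)) (card (verts G))
     (\<lambda>(i, j). if vertex_at G i \<rightarrow>\<^bsub>G\<^esub> vertex_at G j then 1 else 0)"

definition degree_matrix :: "('a::linorder, 'b) pre_digraph \<Rightarrow> real mat" where
  "degree_matrix G = mat (card (verts G)) (card (verts G))
     (\<lambda>(i, j). if i = j then real (out_degree G (vertex_at G i)) else 0)"

definition laplacian :: "('a::linorder, 'b) pre_digraph \<Rightarrow> real mat" where
  "laplacian G = degree_matrix G - adjacency_matrix G"

definition grounded_laplacian :: "('a::linorder, 'b) pre_digraph \<Rightarrow> 'a set \<Rightarrow> real mat" where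
  "grounded_laplacian G S =
     (let I = {i. i < card (verts G) \<and> vertex_at G i \<notin> S} in submatrix (laplacian G) I I)"

definition edge_boundary :: "('a, 'b) pre_digraph \<Rightarrow> 'a set \<Rightarrow> 'a set set" where
  "edge_boundary G S = {{u, v} | u v. u \<in> S \<and> v \<in> verts G - S \<and> u \<rightarrow>\<^bsub>G\<^esub> v}"

text \<open>
  The two eigenvalue functions are meant for real symmetric matrices, of dimension at least 1
  and 2 respectively: all eigenvalues are then real, and the multiset of roots of the
  characteristic polynomial lists them with multiplicity.
\<close>

definition smallest_eigenvalue :: "real mat \<Rightarrow> real" where
  "smallest_eigenvalue A = Min (spectrum A)"

definition second_smallest_eigenvalue :: "real mat \<Rightarrow> real" where
  "second_smallest_eigenvalue A = sorted_list_of_multiset (proots (char_poly A)) ! 1"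

end

theory Submission
  imports Defs "HOL-Analysis.L2_Norm"
begin

text \<open>
  Write \<open>W\<close> for the set of the non-grounded vertices, \<open>m\<close> for its size, \<open>b\<close> for the number of
  boundary edges, \<open>e v\<close> for the number of grounded neighbours of \<open>v \<in> W\<close>, and \<open>L\<close> for the Laplacian
  of the subgraph induced on \<open>W\<close>. The grounded Laplacian is \<open>L\<close> plus the diagonal matrix of \<open>e\<close>, so
  its smallest eigenvalue \<open>t\<close> is the minimum of the Rayleigh quotient of
  \<open>f \<mapsto> D f + (\<Sum>v\<in>W. e v * (f v)\<^sup>2)\<close>, where \<open>D f\<close> is half the sum of \<open>(f v - f u)\<^sup>2\<close> over the
  ordered pairs of adjacent vertices of \<open>W\<close>. The entries of \<open>e\<close> sum to \<open>b\<close>, and constant functions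
  have quotient \<open>b / m\<close>; this is the upper bound.

  For the lower bound, let \<open>\<mu>\<close> be the second smallest eigenvalue of \<open>L\<close> and take a minimizer \<open>f\<close>.
  A large spectral gap \<open>\<mu>\<close> forces \<open>f\<close> to be almost constant. Split \<open>f\<close> into its mean \<open>c\<close> and a part
  \<open>y\<close> of sum zero. With \<open>N\<close> and \<open>T\<close> the squared norms of \<open>f\<close> and \<open>y\<close>, one has \<open>\<mu> * T \<le> t * N\<close>.
  If every \<open>e v\<close> is at most \<open>d\<close>, then also \<open>t \<le> b / m \<le> d\<close>, and so
  \<open>m * c\<^sup>2 = N - T \<ge> (1 - d / \<mu>) * N\<close>. By the Cauchy-Schwarz inequality, the cross term
  \<open>2 * c * (\<Sum>v. e v * y v)\<close> is at most \<open>2 * \<bar>c\<bar> * sqrt (d * b * T)\<close> in absolute value, and hence at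
  most \<open>\<mu> * T + c\<^sup>2 * b * d / \<mu>\<close>. Together these give
  \<open>t * N \<ge> (1 - d / \<mu>) * c\<^sup>2 * b \<ge> (1 - d / \<mu>)\<^sup>2 * (b / m) * N\<close> when \<open>d \<le> \<mu>\<close>, and thus
  \<open>(1 - 2 * d / \<mu>) * (b / m) \<le> t \<le> b / m\<close>; when \<open>d > \<mu>\<close> the left side is at most \<open>0\<close>, while \<open>t \<ge> 0\<close>. Since \<open>e v\<close> is
  bounded both by the number \<open>\<bar>S\<bar>\<close> of grounded vertices and by \<open>b\<close>, their geometric mean
  \<open>sqrt (\<bar>S\<bar> * b)\<close> can serve as \<open>d\<close>. This is \<open>grounded_laplacian_eigenvalue_bounds\<close>,
  from which both asymptotic claims are read off.

  Two facts about a real symmetric matrix carry the linear algebra. Its smallest eigenvalue is the minimum of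
  the Rayleigh quotient (\<open>smallest_eigenvalue_Rayleigh\<close>). If moreover the matrix is positive
  semidefinite and kills a unit vector \<open>u\<close>, its second smallest eigenvalue is the minimum of the quotient on
  the orthogonal complement of \<open>u\<close> (\<open>second_smallest_eigenvalue_Rayleigh\<close>); this is proved by splitting off \<open>u\<close>
  with a reflection. Connectedness of the induced subgraph makes \<open>\<mu>\<close> positive.
\<close>

section \<open>Rayleigh quotients of real symmetric matrices\<close>

lemma Cauchy_Schwarz_sum:
  fixes f g :: "'a \<Rightarrow> real"
  shows "(\<Sum>i\<in>A. f i * g i)\<^sup>2 \<le> (\<Sum>i\<in>A. (f i)\<^sup>2) * (\<Sum>i\<in>A. (g i)\<^sup>2)"
proof -
  have "\<bar>\<Sum>i\<in>A. f i * g i\<bar> \<le> (\<Sum>i\<in>A. \<bar>f i\<bar> * \<bar>g i\<bar>)"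
    using sum_abs[of "\<lambda>i. f i * g i" A] by (simp add: abs_mult)
  also have "\<dots> \<le> L2_set f A * L2_set g A"
    by (rule L2_set_mult_ineq)
  finally have "\<bar>\<Sum>i\<in>A. f i * g i\<bar>\<^sup>2 \<le> (L2_set f A * L2_set g A)\<^sup>2"
    by (rule power_mono) simp
  thus ?thesis
    by (simp add: L2_set_def power_mult_distrib sum_nonneg)
qed

lemma scalar_prod_self_nonneg: "0 \<le> x \<bullet> x" for x :: "real vec"
  by (simp add: scalar_prod_def sum_nonneg)

lemma scalar_prod_self_pos:
  fixes x :: "real vec"
  assumes "x \<in> carrier_vec n" "x \<noteq> 0\<^sub>v n"
  shows "x \<bullet> x > 0"
proof -
  obtain i where "i < n" "x $ i \<noteq> 0"
    using assms by (metis carrier_vecD eq_vecI index_zero_vec)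
  thus ?thesis
    using assms unfolding scalar_prod_def by (intro sum_pos2[of _ i]) (auto simp: zero_less_mult_iff)
qed

lemma mat_mult_vec_bound:
  fixes M :: "real mat"
  assumes M: "M \<in> carrier_mat n n"
  obtains C where "C > 0" "\<And>x. x \<in> carrier_vec n \<Longrightarrow> (M *\<^sub>v x) \<bullet> (M *\<^sub>v x) \<le> C * (x \<bullet> x)"
proof
  define C where "C = 1 + (\<Sum>i = 0..<n. \<Sum>j = 0..<n. (M $$ (i, j))\<^sup>2)"
  show "C > 0"
    unfolding C_def by (intro add_pos_nonneg sum_nonneg) auto
  fix x :: "real vec" assume x: "x \<in> carrier_vec n"
  have "(M *\<^sub>v x) \<bullet> (M *\<^sub>v x) = (\<Sum>i = 0..<n. (\<Sum>j = 0..<n. M $$ (i, j) * x $ j)\<^sup>2)"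
    using M x by (auto simp: scalar_prod_def power2_eq_square intro!: sum.cong)
  also have "\<dots> \<le> (\<Sum>i = 0..<n. (\<Sum>j = 0..<n. (M $$ (i, j))\<^sup>2) * (\<Sum>j = 0..<n. (x $ j)\<^sup>2))"
    by (intro sum_mono Cauchy_Schwarz_sum)
  also have "\<dots> = (C - 1) * (x \<bullet> x)"
    using x by (simp add: C_def scalar_prod_def power2_eq_square sum_distrib_right)
  also have "\<dots> \<le> C * (x \<bullet> x)"
    using scalar_prod_self_nonneg[of x] by (simp add: algebra_simps)
  finally show "(M *\<^sub>v x) \<bullet> (M *\<^sub>v x) \<le> C * (x \<bullet> x)" .
qed

lemma quadratic_form_bound:
  fixes M :: "real mat"
  assumes M: "M \<in> carrier_mat n n"
  obtains C where "C > 0" "\<And>x. x \<in> carrier_vec n \<Longrightarrow> \<bar>x \<bullet> (M *\<^sub>v x)\<bar> \<le> C * (x \<bullet> x)"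
proof -
  obtain C where C: "C > 0"
    "\<And>x. x \<in> carrier_vec n \<Longrightarrow> (M *\<^sub>v x) \<bullet> (M *\<^sub>v x) \<le> C * (x \<bullet> x)"
    using mat_mult_vec_bound[OF M] by blast
  show thesis
  proof (rule that)
    show "(1 + C) / 2 > 0" using C by simp
    fix x :: "real vec" assume x: "x \<in> carrier_vec n"
    let ?y = "M *\<^sub>v x"
    have y: "?y \<in> carrier_vec n" using M x by simp
    have "0 \<le> (x + ?y) \<bullet> (x + ?y)" "0 \<le> (x - ?y) \<bullet> (x - ?y)"
      by (rule scalar_prod_self_nonneg)+
    moreover have "(x + ?y) \<bullet> (x + ?y) = x \<bullet> x + 2 * (x \<bullet> ?y) + ?y \<bullet> ?y"
      using x y by (simp add: scalar_prod_add_distrib[where n = n] add_scalar_prod_distrib[where n = n]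
          comm_scalar_prod[of ?y n x])
    moreover have "(x - ?y) \<bullet> (x - ?y) = x \<bullet> x - 2 * (x \<bullet> ?y) + ?y \<bullet> ?y"
      using x y by (simp add: scalar_prod_minus_distrib[where n = n] minus_scalar_prod_distrib[where n = n]
          comm_scalar_prod[of ?y n x])
    ultimately show "\<bar>x \<bullet> ?y\<bar> \<le> (1 + C) / 2 * (x \<bullet> x)"
      using C(2)[OF x] by (simp add: algebra_simps abs_le_iff)
  qed
qed

lemma symmetric_mat_scalar_prod:
  fixes A :: "'a :: comm_semiring_0 mat"
  assumes "A \<in> carrier_mat n n" "A\<^sup>T = A" "x \<in> carrier_vec n" "y \<in> carrier_vec n"
  shows "(A *\<^sub>v x) \<bullet> y = x \<bullet> (A *\<^sub>v y)"
  using transpose_vec_mult_scalar[OF assms(1,4,3)] assms(2) by simp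

text \<open>
  Evaluating the form at \<open>y - (1 / C) B y\<close>, a
  gradient step, bounds the squared norm of \<open>B y\<close> by \<open>C\<close> times the form at \<open>y\<close>; an inverse of \<open>B\<close>
  then bounds the norm of \<open>y\<close> itself.
\<close>
lemma nonsingular_psd_coercive:
  fixes B :: "real mat"
  assumes B: "B \<in> carrier_mat n n" "B\<^sup>T = B" and det: "det B \<noteq> 0"
    and psd: "\<And>x. x \<in> carrier_vec n \<Longrightarrow> 0 \<le> x \<bullet> (B *\<^sub>v x)"
  obtains \<epsilon> where "\<epsilon> > 0" "\<And>x. x \<in> carrier_vec n \<Longrightarrow> \<epsilon> * (x \<bullet> x) \<le> x \<bullet> (B *\<^sub>v x)"
proof -
  obtain R where R: "R \<in> carrier_mat n n" "R * B = 1\<^sub>m n"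
    using det_non_zero_imp_unit[OF B(1) det, of "()"]
    by (auto simp: Units_def ring_mat_def)
  obtain C where C: "C > 0" "\<And>x. x \<in> carrier_vec n \<Longrightarrow> \<bar>x \<bullet> (B *\<^sub>v x)\<bar> \<le> C * (x \<bullet> x)"
    using quadratic_form_bound[OF B(1)] by blast
  obtain D where D: "D > 0" "\<And>x. x \<in> carrier_vec n \<Longrightarrow> (R *\<^sub>v x) \<bullet> (R *\<^sub>v x) \<le> D * (x \<bullet> x)"
    using mat_mult_vec_bound[OF R(1)] by blast
  show thesis
  proof (rule that)
    show "1 / (C * D) > 0" using C D by simp
    fix y :: "real vec" assume y: "y \<in> carrier_vec n"
    define z where "z = B *\<^sub>v y"
    have z: "z \<in> carrier_vec n" and Bz: "B *\<^sub>v z \<in> carrier_vec n" using B y by (auto simp: z_def)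
    let ?w = "y - (1 / C) \<cdot>\<^sub>v z"
    have w: "?w \<in> carrier_vec n" using y z by simp
    have "B *\<^sub>v ?w = z - (1 / C) \<cdot>\<^sub>v (B *\<^sub>v z)"
      using B y z by (simp add: mult_minus_distrib_mat_vec mult_mat_vec z_def)
    hence "?w \<bullet> (B *\<^sub>v ?w) =
        y \<bullet> z - (1 / C) * (y \<bullet> (B *\<^sub>v z)) - (1 / C) * (z \<bullet> z) + (1 / C)\<^sup>2 * (z \<bullet> (B *\<^sub>v z))"
      using y z Bz
      by (simp add: scalar_prod_minus_distrib[where n = n] minus_scalar_prod_distrib[where n = n]
          power2_eq_square algebra_simps)
    also have "y \<bullet> (B *\<^sub>v z) = z \<bullet> z"
      using symmetric_mat_scalar_prod[OF B y z] by (simp add: z_def)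
    also have "(1 / C)\<^sup>2 * (z \<bullet> (B *\<^sub>v z)) \<le> (1 / C)\<^sup>2 * (C * (z \<bullet> z))"
      using C(2)[OF z] by (intro mult_left_mono) auto
    also have "\<dots> = (1 / C) * (z \<bullet> z)"
      using C(1) by (simp add: power2_eq_square)
    finally have "(1 / C) * (z \<bullet> z) \<le> y \<bullet> z"
      using psd[OF w] by simp
    hence zz: "z \<bullet> z \<le> C * (y \<bullet> z)"
      using C(1) by (simp add: field_simps)
    have "R *\<^sub>v z = y"
      using R B y by (simp add: z_def assoc_mult_mat_vec[symmetric, where ?n\<^sub>1 = n and ?n\<^sub>2 = n and ?n\<^sub>3 = n])
    hence "y \<bullet> y \<le> D * (z \<bullet> z)"
      using D(2)[OF z] by simp
    also have "\<dots> \<le> D * (C * (y \<bullet> z))"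
      using zz D(1) by simp
    finally show "1 / (C * D) * (y \<bullet> y) \<le> y \<bullet> (B *\<^sub>v y)"
      using C(1) D(1) by (simp add: z_def field_simps)
  qed
qed

lemma eigenvector_quadratic_form:
  fixes A :: "real mat"
  assumes "A \<in> carrier_mat n n" and "eigenvalue A k"
  obtains x where "x \<in> carrier_vec n" "x \<bullet> x > 0" "x \<bullet> (A *\<^sub>v x) = k * (x \<bullet> x)"
proof -
  obtain x where x: "x \<in> carrier_vec n" "x \<noteq> 0\<^sub>v n" "A *\<^sub>v x = k \<cdot>\<^sub>v x"
    using assms by (auto simp: eigenvalue_def eigenvector_def)
  have "x \<bullet> x > 0"
    using scalar_prod_self_pos[OF x(1,2)] .
  thus thesis
    using x by (intro that[of x]) auto
qed

text \<open>
  The minimum \<open>t\<close> is the supremum of all shifts that keep \<open>A - t\<close> positive semidefinite. At the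
  supremum \<open>A - t\<close> must be singular, since otherwise it would be coercive and could be shifted further.
\<close>
lemma symmetric_mat_Rayleigh_minimum:
  fixes A :: "real mat"
  assumes A: "A \<in> carrier_mat n n" "A\<^sup>T = A" and n: "n > 0"
  obtains t where "eigenvalue A t"
    "\<And>x. x \<in> carrier_vec n \<Longrightarrow> t * (x \<bullet> x) \<le> x \<bullet> (A *\<^sub>v x)"
proof -
  define T where "T = {t. \<forall>x \<in> carrier_vec n. t * (x \<bullet> x) \<le> x \<bullet> (A *\<^sub>v x)}"
  obtain C where C: "C > 0" "\<And>x. x \<in> carrier_vec n \<Longrightarrow> \<bar>x \<bullet> (A *\<^sub>v x)\<bar> \<le> C * (x \<bullet> x)"
    using quadratic_form_bound[OF A(1)] by blast
  have "- C \<in> T"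
    unfolding T_def using C(2) by (force simp: abs_le_iff)
  hence ne: "T \<noteq> {}" by blast
  let ?e = "unit_vec n 0 :: real vec"
  have bdd: "bdd_above T"
  proof (rule bdd_aboveI)
    fix t assume "t \<in> T"
    hence "t * (?e \<bullet> ?e) \<le> ?e \<bullet> (A *\<^sub>v ?e)" unfolding T_def by simp
    thus "t \<le> ?e \<bullet> (A *\<^sub>v ?e)" using n by simp
  qed
  define t where "t = Sup T"
  have t: "t * (x \<bullet> x) \<le> x \<bullet> (A *\<^sub>v x)" if x: "x \<in> carrier_vec n" for x
  proof (cases "x \<bullet> x = 0")
    case True
    thus ?thesis using C(2)[OF x] by simp
  next
    case False
    hence pos: "x \<bullet> x > 0" using scalar_prod_self_nonneg[of x] by linarith
    have "t \<le> (x \<bullet> (A *\<^sub>v x)) / (x \<bullet> x)"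
      unfolding t_def by (intro cSup_least ne) (use x pos in \<open>auto simp: T_def field_simps\<close>)
    thus ?thesis using pos by (simp add: field_simps)
  qed
  have "eigenvalue A t"
  proof (rule ccontr)
    assume no: "\<not> eigenvalue A t"
    let ?B = "char_matrix A t"
    have B: "?B \<in> carrier_mat n n" "?B\<^sup>T = ?B"
      using A unfolding char_matrix_def by (auto simp: transpose_add[where nr = n and nc = n])
    have Bx: "x \<bullet> (?B *\<^sub>v x) = x \<bullet> (A *\<^sub>v x) - t * (x \<bullet> x)" if x: "x \<in> carrier_vec n" for x
    proof -
      have "?B *\<^sub>v x = A *\<^sub>v x + (- t) \<cdot>\<^sub>v x"
        unfolding char_matrix_def using A x
        by (subst add_mult_distrib_mat_vec[where nr = n and nc = n]) auto
      thus ?thesis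
        using A x by (simp add: scalar_prod_add_distrib[where n = n])
    qed
    have "det ?B \<noteq> 0" using no eigenvalue_det[OF A(1)] by simp
    then obtain \<epsilon> where \<epsilon>: "\<epsilon> > 0" "\<And>x. x \<in> carrier_vec n \<Longrightarrow> \<epsilon> * (x \<bullet> x) \<le> x \<bullet> (?B *\<^sub>v x)"
      using nonsingular_psd_coercive[OF B] t Bx by (metis diff_ge_0_iff_ge)
    have "t + \<epsilon> \<in> T"
      unfolding T_def using \<epsilon>(2) Bx by (auto simp: algebra_simps)
    hence "t + \<epsilon> \<le> t" unfolding t_def by (intro cSup_upper bdd)
    thus False using \<epsilon>(1) by simp
  qed
  thus thesis using t that by blast
qed

lemma smallest_eigenvalue_Rayleigh:
  fixes A :: "real mat"
  assumes A: "A \<in> carrier_mat n n" "A\<^sup>T = A" and n: "n > 0"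
  shows "eigenvalue A (smallest_eigenvalue A)"
    and "x \<in> carrier_vec n \<Longrightarrow> smallest_eigenvalue A * (x \<bullet> x) \<le> x \<bullet> (A *\<^sub>v x)"
    and "eigenvalue A k \<Longrightarrow> smallest_eigenvalue A \<le> k"
proof -
  obtain t where t: "eigenvalue A t"
    "\<And>x. x \<in> carrier_vec n \<Longrightarrow> t * (x \<bullet> x) \<le> x \<bullet> (A *\<^sub>v x)"
    using symmetric_mat_Rayleigh_minimum[OF assms] by blast
  have min: "t \<le> k" if ev: "eigenvalue A k" for k
  proof -
    obtain x where "x \<in> carrier_vec n" "x \<bullet> x > 0" "x \<bullet> (A *\<^sub>v x) = k * (x \<bullet> x)"
      using eigenvector_quadratic_form[OF A(1) ev] by blast
    thus ?thesis using t(2)[of x] by simp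
  qed
  have eq: "smallest_eigenvalue A = t"
    unfolding smallest_eigenvalue_def
    by (rule Min_eqI) (use card_finite_spectrum(1)[OF A(1)] min t(1) in \<open>auto simp: spectrum_def\<close>)
  show "eigenvalue A (smallest_eigenvalue A)"
    and "x \<in> carrier_vec n \<Longrightarrow> smallest_eigenvalue A * (x \<bullet> x) \<le> x \<bullet> (A *\<^sub>v x)"
    and "eigenvalue A k \<Longrightarrow> smallest_eigenvalue A \<le> k"
    using t min unfolding eq by auto
qed

text \<open>
  The reflection in the hyperplane orthogonal to \<open>u - e\<close>, where \<open>e\<close> is the first unit vector, swaps the
  unit vectors \<open>u\<close> and \<open>e\<close>.
\<close>
lemma householder_reflection:
  fixes u :: "real vec"
  assumes u: "u \<in> carrier_vec n" "u \<bullet> u = 1" and n: "n > 0"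
  obtains W where "W \<in> carrier_mat n n" "W\<^sup>T = W" "W * W = 1\<^sub>m n" "W *\<^sub>v unit_vec n 0 = u"
proof (cases "u = unit_vec n 0")
  case True
  show thesis
    by (rule that[of "1\<^sub>m n"]) (use True in auto)
next
  case False
  define w where "w = u - unit_vec n 0"
  have w: "w \<in> carrier_vec n" using u by (simp add: w_def)
  have "w \<noteq> 0\<^sub>v n"
  proof
    assume "w = 0\<^sub>v n"
    hence "(u - unit_vec n 0) $ i = 0" if "i < n" for i
      using that unfolding w_def by simp
    hence "u $ i = unit_vec n 0 $ i" if "i < n" for i
      using that u by simp
    thus False using False u by (auto intro: eq_vecI)
  qed
  hence pos: "w \<bullet> w > 0" by (rule scalar_prod_self_pos[OF w])
  have wu: "w \<bullet> unit_vec n 0 = u $ 0 - 1"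
    using u n by (simp add: w_def)
  have ww: "w \<bullet> w = 2 * (1 - u $ 0)"
    using u n by (simp add: w_def scalar_prod_minus_distrib[where n = n] minus_scalar_prod_distrib[where n = n])
  define \<beta> where "\<beta> = 2 / (w \<bullet> w)"
  define W where "W = mat n n (\<lambda>(i, j). (if i = j then 1 else 0) - \<beta> * w $ i * w $ j)"
  have W: "W \<in> carrier_mat n n" by (simp add: W_def)
  have Wx: "W *\<^sub>v x = x - (\<beta> * (w \<bullet> x)) \<cdot>\<^sub>v w" if x: "x \<in> carrier_vec n" for x
  proof (rule eq_vecI)
    fix i assume "i < dim_vec (x - (\<beta> * (w \<bullet> x)) \<cdot>\<^sub>v w)"
    hence i: "i < n" using w by simp
    have "(W *\<^sub>v x) $ i = (\<Sum>j = 0..<n. ((if i = j then 1 else 0) - \<beta> * w $ i * w $ j) * x $ j)"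
      using i x by (simp add: W_def scalar_prod_def)
    also have "\<dots> = (\<Sum>j = 0..<n. (if i = j then x $ j else 0)) - \<beta> * w $ i * (\<Sum>j = 0..<n. w $ j * x $ j)"
      unfolding sum_distrib_left sum_subtractf[symmetric]
      by (intro sum.cong) (auto simp: algebra_simps)
    also have "\<dots> = x $ i - \<beta> * w $ i * (w \<bullet> x)"
      using i x by (simp add: scalar_prod_def)
    finally show "(W *\<^sub>v x) $ i = (x - (\<beta> * (w \<bullet> x)) \<cdot>\<^sub>v w) $ i"
      using i x w by (simp add: algebra_simps)
  qed (use w in \<open>simp add: W_def\<close>)
  show thesis
  proof (rule that[OF W])
    show "W\<^sup>T = W" by (rule eq_matI) (auto simp: W_def algebra_simps)
    show "W *\<^sub>v unit_vec n 0 = u"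
    proof -
      have "\<beta> * (w \<bullet> unit_vec n 0) = - 1"
        using pos unfolding \<beta>_def wu ww by (simp add: field_simps)
      hence "W *\<^sub>v unit_vec n 0 = unit_vec n 0 + w"
        using Wx[of "unit_vec n 0"] w by (auto intro!: eq_vecI)
      also have "\<dots> = u" using u by (auto simp: w_def intro!: eq_vecI)
      finally show ?thesis .
    qed
    show "W * W = 1\<^sub>m n"
    proof (rule eq_matI)
      fix i j assume "i < dim_row (1\<^sub>m n :: real mat)" "j < dim_col (1\<^sub>m n :: real mat)"
      hence i: "i < n" and j: "j < n" by auto
      let ?c = "col W j"
      have c: "?c = unit_vec n j - (\<beta> * w $ j) \<cdot>\<^sub>v w"
        using i j w by (intro eq_vecI) (auto simp: W_def algebra_simps)
      have "w \<bullet> ?c = w $ j - \<beta> * w $ j * (w \<bullet> w)"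
        unfolding c using j w by (simp add: scalar_prod_minus_distrib[where n = n])
      also have "\<dots> = - w $ j" using pos by (simp add: \<beta>_def)
      finally have "W *\<^sub>v ?c = ?c - (- \<beta> * w $ j) \<cdot>\<^sub>v w"
        using Wx[of ?c] col_carrier_vec[OF _ W] j by simp
      also have "\<dots> = unit_vec n j"
        unfolding c using j w by (intro eq_vecI) auto
      finally have "(W *\<^sub>v ?c) $ i = 1\<^sub>m n $$ (i, j)" using i j by simp
      thus "(W * W) $$ (i, j) = 1\<^sub>m n $$ (i, j)" using i j W by simp
    qed (use W in auto)
  qed
qed

text \<open>
  Conjugating with the reflection makes the eigenvector \<open>u\<close> the first unit vector; by symmetry the first
  row and column then vanish off the diagonal, and the remaining block \<open>B\<close> represents \<open>A\<close> on the
  orthogonal complement of \<open>u\<close>. The last two conclusions say that this identification preserves norms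
  and quadratic forms in both directions.
\<close>
lemma symmetric_mat_deflation:
  fixes A :: "real mat"
  assumes A: "A \<in> carrier_mat (Suc k) (Suc k)" "A\<^sup>T = A"
    and u: "u \<in> carrier_vec (Suc k)" "u \<bullet> u = 1" and Au: "A *\<^sub>v u = e \<cdot>\<^sub>v u"
  obtains B where "B \<in> carrier_mat k k" "B\<^sup>T = B" "char_poly A = [:- e, 1:] * char_poly B"
    "\<And>z. z \<in> carrier_vec k \<Longrightarrow>
       \<exists>y \<in> carrier_vec (Suc k). y \<bullet> u = 0 \<and> y \<bullet> y = z \<bullet> z \<and> y \<bullet> (A *\<^sub>v y) = z \<bullet> (B *\<^sub>v z)"
    "\<And>y. y \<in> carrier_vec (Suc k) \<Longrightarrow> y \<bullet> u = 0 \<Longrightarrow>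
       \<exists>z \<in> carrier_vec k. z \<bullet> z = y \<bullet> y \<and> z \<bullet> (B *\<^sub>v z) = y \<bullet> (A *\<^sub>v y)"
proof -
  let ?n = "Suc k"
  let ?e = "unit_vec ?n 0 :: real vec"
  obtain W where W: "W \<in> carrier_mat ?n ?n" "W\<^sup>T = W" "W * W = 1\<^sub>m ?n" "W *\<^sub>v ?e = u"
    using householder_reflection[OF u] by blast
  have WW: "W *\<^sub>v (W *\<^sub>v x) = x" if "x \<in> carrier_vec ?n" for x
    using that W by (simp add: assoc_mult_mat_vec[symmetric, where ?n\<^sub>1 = ?n and ?n\<^sub>2 = ?n and ?n\<^sub>3 = ?n])
  define A' where "A' = W * A * W"
  have A': "A' \<in> carrier_mat ?n ?n" using A W by (simp add: A'_def)
  have A'x: "A' *\<^sub>v x = W *\<^sub>v (A *\<^sub>v (W *\<^sub>v x))" if "x \<in> carrier_vec ?n" for x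
    using that A W by (simp add: A'_def assoc_mult_mat_vec[where ?n\<^sub>1 = ?n and ?n\<^sub>2 = ?n and ?n\<^sub>3 = ?n])
  have "A'\<^sup>T = W * (A * W)"
    using A W by (simp add: A'_def transpose_mult[where nr = ?n and n = ?n and nc = ?n])
  also have "\<dots> = A'"
    using A W by (simp add: A'_def)
  finally have A'T: "A'\<^sup>T = A'" .
  have sym: "A' $$ (i, j) = A' $$ (j, i)" if "i < ?n" "j < ?n" for i j
    using that A' arg_cong[OF A'T, of "\<lambda>M. M $$ (i, j)"] by simp
  have "A' *\<^sub>v ?e = e \<cdot>\<^sub>v ?e"
    using A W u Au WW[of ?e] by (simp add: A'x mult_mat_vec)
  moreover have "(A' *\<^sub>v ?e) $ i = A' $$ (i, 0)" if "i < ?n" for i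
    using that A' by simp
  ultimately have col0: "A' $$ (i, 0) = (if i = 0 then e else 0)" if "i < ?n" for i
    using that by (metis index_smult_vec(1) index_unit_vec(1) dim_vec mult.right_neutral mult_zero_right
        unit_vec_def zero_less_Suc)
  define B where "B = mat k k (\<lambda>(i, j). A' $$ (Suc i, Suc j))"
  have B: "B \<in> carrier_mat k k" by (simp add: B_def)
  let ?E = "mat 1 1 (\<lambda>_. e)"
  have block: "A' = four_block_mat ?E (0\<^sub>m 1 k) (0\<^sub>m k 1) B"
    using A' col0 sym by (intro eq_matI) (auto simp: B_def)
  have "similar_mat A' A"
    unfolding similar_mat_def
    by (intro exI[of _ W] similar_mat_witI[of _ _ ?n]) (use A A' W in \<open>auto simp: A'_def\<close>)
  hence "char_poly A = char_poly A'" by (metis char_poly_similar)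
  also have "\<dots> = char_poly ?E * char_poly B"
    unfolding block using B by (intro char_poly_four_block_zeros_col) auto
  also have "char_poly ?E = [:- e, 1:]"
    by (simp add: char_poly_defs det_def sign_def)
  finally have cp: "char_poly A = [:- e, 1:] * char_poly B" .
  have form: "(W *\<^sub>v x) \<bullet> (A *\<^sub>v (W *\<^sub>v x)) = x \<bullet> (A' *\<^sub>v x)" and norm: "(W *\<^sub>v x) \<bullet> (W *\<^sub>v x) = x \<bullet> x"
    and first: "(W *\<^sub>v x) \<bullet> u = x $ 0" if x: "x \<in> carrier_vec ?n" for x
  proof -
    show "(W *\<^sub>v x) \<bullet> (A *\<^sub>v (W *\<^sub>v x)) = x \<bullet> (A' *\<^sub>v x)"
      using symmetric_mat_scalar_prod[OF W(1,2) x, of "A *\<^sub>v (W *\<^sub>v x)"] A'x[OF x] A W x by simp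
    show "(W *\<^sub>v x) \<bullet> (W *\<^sub>v x) = x \<bullet> x"
      using symmetric_mat_scalar_prod[OF W(1,2) x, of "W *\<^sub>v x"] WW[OF x] W x by simp
    show "(W *\<^sub>v x) \<bullet> u = x $ 0"
      using symmetric_mat_scalar_prod[OF W(1,2) x, of u] WW[of ?e] W x u by simp
  qed
  have Bz: "(0\<^sub>v 1 @\<^sub>v z) \<bullet> (A' *\<^sub>v (0\<^sub>v 1 @\<^sub>v z)) = z \<bullet> (B *\<^sub>v z)"
    and nz: "(0\<^sub>v 1 @\<^sub>v z) \<bullet> (0\<^sub>v 1 @\<^sub>v z) = z \<bullet> z" if z: "z \<in> carrier_vec k" for z
  proof -
    have "A' *\<^sub>v (0\<^sub>v 1 @\<^sub>v z) = 0\<^sub>v 1 @\<^sub>v (B *\<^sub>v z)"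
      unfolding block using B z by (subst four_block_mat_mult_vec) auto
    thus "(0\<^sub>v 1 @\<^sub>v z) \<bullet> (A' *\<^sub>v (0\<^sub>v 1 @\<^sub>v z)) = z \<bullet> (B *\<^sub>v z)"
      using B z by (simp add: scalar_prod_append[where ?n1.0 = 1 and ?n2.0 = k])
    show "(0\<^sub>v 1 @\<^sub>v z) \<bullet> (0\<^sub>v 1 @\<^sub>v z) = z \<bullet> z"
      using z by (simp add: scalar_prod_append[where ?n1.0 = 1 and ?n2.0 = k])
  qed
  show thesis
  proof (rule that[OF B _ cp])
    show "B\<^sup>T = B" using sym by (intro eq_matI) (auto simp: B_def)
    fix z :: "real vec" assume z: "z \<in> carrier_vec k"
    let ?x = "0\<^sub>v 1 @\<^sub>v z"
    have x: "?x \<in> carrier_vec ?n" using append_carrier_vec[of "0\<^sub>v 1" 1 z k] z by simp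
    show "\<exists>y \<in> carrier_vec ?n. y \<bullet> u = 0 \<and> y \<bullet> y = z \<bullet> z \<and> y \<bullet> (A *\<^sub>v y) = z \<bullet> (B *\<^sub>v z)"
      using form[OF x] norm[OF x] first[OF x] Bz[OF z] nz[OF z] W x
      by (intro bexI[of _ "W *\<^sub>v ?x"]) auto
  next
    fix y :: "real vec" assume y: "y \<in> carrier_vec ?n" "y \<bullet> u = 0"
    define x where "x = W *\<^sub>v y"
    have x: "x \<in> carrier_vec ?n" "W *\<^sub>v x = y" using W y WW by (auto simp: x_def)
    define z where "z = vec_last x k"
    have z: "z \<in> carrier_vec k" by (simp add: z_def)
    have "x $ 0 = 0" using first[OF x(1)] x(2) y(2) by simp
    hence "vec_first x 1 = 0\<^sub>v 1"
      by (intro eq_vecI) (auto simp: vec_first_def)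
    moreover have "x = vec_first x 1 @\<^sub>v z"
      using vec_first_last_append[of x 1 k] x by (simp add: z_def)
    ultimately have xz: "x = 0\<^sub>v 1 @\<^sub>v z" by simp
    show "\<exists>z \<in> carrier_vec k. z \<bullet> z = y \<bullet> y \<and> z \<bullet> (B *\<^sub>v z) = y \<bullet> (A *\<^sub>v y)"
      using form[OF x(1), unfolded x(2), unfolded xz] norm[OF x(1), unfolded x(2), unfolded xz]
        Bz[OF z] nz[OF z] z by (intro bexI[of _ z]) auto
  qed
qed

text \<open>
  After splitting off \<open>u\<close>, the roots of the characteristic polynomial are \<open>0\<close> and those of the block
  \<open>B\<close>. The latter are nonnegative, so the second smallest root of \<open>A\<close>, with multiplicity, is the
  smallest one of \<open>B\<close>, to which the Rayleigh principle applies.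
\<close>
lemma second_smallest_eigenvalue_Rayleigh:
  fixes A :: "real mat"
  assumes A: "A \<in> carrier_mat n n" "A\<^sup>T = A" and n: "n \<ge> 2"
    and psd: "\<And>x. x \<in> carrier_vec n \<Longrightarrow> 0 \<le> x \<bullet> (A *\<^sub>v x)"
    and u: "u \<in> carrier_vec n" "u \<bullet> u = 1" and Au: "A *\<^sub>v u = 0\<^sub>v n"
  shows "\<lbrakk>y \<in> carrier_vec n; y \<bullet> u = 0\<rbrakk> \<Longrightarrow> second_smallest_eigenvalue A * (y \<bullet> y) \<le> y \<bullet> (A *\<^sub>v y)"
    and "\<exists>y \<in> carrier_vec n. y \<bullet> u = 0 \<and> y \<bullet> y > 0 \<and>
           y \<bullet> (A *\<^sub>v y) = second_smallest_eigenvalue A * (y \<bullet> y)"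
proof -
  obtain k where k: "n = Suc k" "k > 0" using n by (cases n) auto
  have "A *\<^sub>v u = 0 \<cdot>\<^sub>v u" using Au u by auto
  then obtain B where B: "B \<in> carrier_mat k k" "B\<^sup>T = B" "char_poly A = [:- 0, 1:] * char_poly B"
    "\<And>z. z \<in> carrier_vec k \<Longrightarrow>
       \<exists>y \<in> carrier_vec n. y \<bullet> u = 0 \<and> y \<bullet> y = z \<bullet> z \<and> y \<bullet> (A *\<^sub>v y) = z \<bullet> (B *\<^sub>v z)"
    "\<And>y. y \<in> carrier_vec n \<Longrightarrow> y \<bullet> u = 0 \<Longrightarrow>
       \<exists>z \<in> carrier_vec k. z \<bullet> z = y \<bullet> y \<and> z \<bullet> (B *\<^sub>v z) = y \<bullet> (A *\<^sub>v y)"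
    using symmetric_mat_deflation[of A k u 0] A u unfolding k(1) by metis
  define t where "t = smallest_eigenvalue B"
  note ray = smallest_eigenvalue_Rayleigh[OF B(1,2) k(2), folded t_def]
  obtain z where z: "z \<in> carrier_vec k" "z \<bullet> z > 0" "z \<bullet> (B *\<^sub>v z) = t * (z \<bullet> z)"
    using eigenvector_quadratic_form[OF B(1) ray(1)] by blast
  obtain y where y: "y \<in> carrier_vec n" "y \<bullet> u = 0" "y \<bullet> y = z \<bullet> z" "y \<bullet> (A *\<^sub>v y) = z \<bullet> (B *\<^sub>v z)"
    using B(4)[OF z(1)] by blast
  have t0: "t \<ge> 0"
    using psd[OF y(1)] y z by (simp add: zero_le_mult_iff)
  have B0: "char_poly B \<noteq> 0" using degree_monic_char_poly[OF B(1)] by auto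
  define P where "P = proots (char_poly B)"
  have P: "r \<in># P \<longleftrightarrow> eigenvalue B r" for r
    using B0 by (simp add: P_def eigenvalue_root_char_poly[OF B(1)])
  have min: "t \<le> r" if "r \<in># P" for r using that ray(3) P by simp
  define l where "l = sorted_list_of_multiset P"
  have l: "sorted l" "set l = set_mset P" by (auto simp: l_def)
  have tl: "t \<in> set l" using P ray(1) l by simp
  have "proots (char_poly A) = add_mset 0 P"
    unfolding B(3) P_def using B0 by (subst proots_mult) auto
  hence "sorted_list_of_multiset (proots (char_poly A)) = 0 # l"
    using t0 min l by (simp add: l_def[symmetric] insort_is_Cons order_trans[OF t0])
  hence "second_smallest_eigenvalue A = l ! 0"
    by (simp add: second_smallest_eigenvalue_def)
  also have "l ! 0 = t"
  proof (rule antisym)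
    from tl obtain i where "i < length l" "l ! i = t" by (auto simp: in_set_conv_nth)
    thus "l ! 0 \<le> t" using sorted_nth_mono[OF l(1), of 0 i] by simp
    have "l ! 0 \<in> set l" using tl by (cases l) auto
    thus "t \<le> l ! 0" using l min by simp
  qed
  finally have eq: "second_smallest_eigenvalue A = t" .
  show "second_smallest_eigenvalue A * (y \<bullet> y) \<le> y \<bullet> (A *\<^sub>v y)" if "y \<in> carrier_vec n" "y \<bullet> u = 0" for y
    using B(5)[OF that] ray(2) unfolding eq by force
  show "\<exists>y \<in> carrier_vec n. y \<bullet> u = 0 \<and> y \<bullet> y > 0 \<and>
           y \<bullet> (A *\<^sub>v y) = second_smallest_eigenvalue A * (y \<bullet> y)"
    unfolding eq using y z by (intro bexI[of _ y]) auto
qed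

section \<open>Dirichlet forms on a finite vertex set\<close>

text \<open>
  The sum ranges over ordered pairs, so that every edge is met twice; this accounts for the factor one
  half.
\<close>
definition dirichlet_form :: "'v set \<Rightarrow> ('v \<Rightarrow> 'v \<Rightarrow> bool) \<Rightarrow> ('v \<Rightarrow> real) \<Rightarrow> real" where
  "dirichlet_form V E f = (\<Sum>v\<in>V. \<Sum>u\<in>V. if E v u then (f v - f u)\<^sup>2 else 0) / 2"

lemma dirichlet_form_nonneg: "0 \<le> dirichlet_form V E f"
  by (auto simp: dirichlet_form_def intro!: sum_nonneg)

lemma dirichlet_form_shift: "dirichlet_form V E (\<lambda>v. f v + c) = dirichlet_form V E f"
  unfolding dirichlet_form_def add_diff_cancel_right ..

text \<open>Summation by parts, using that the two orientations of an edge contribute the same.\<close>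
lemma dirichlet_form_eq:
  assumes V: "finite V" and sym: "symp E"
  shows "(\<Sum>v\<in>V. f v * (\<Sum>u\<in>V. ((if v = u then real (card {w \<in> V. E v w}) + e v else 0)
            - (if E v u then 1 else 0)) * f u))
       = dirichlet_form V E f + (\<Sum>v\<in>V. e v * (f v)\<^sup>2)"
proof -
  let ?S = "\<lambda>h. \<Sum>v\<in>V. \<Sum>u\<in>V. if E v u then h v u else (0::real)"
  have 1: "f v * (\<Sum>u\<in>V. ((if v = u then real (card {w \<in> V. E v w}) + e v else 0)
            - (if E v u then 1 else 0)) * f u)
       = (\<Sum>u\<in>V. if E v u then (f v)\<^sup>2 else 0) - (\<Sum>u\<in>V. if E v u then f v * f u else 0) + e v * (f v)\<^sup>2"
    if v: "v \<in> V" for v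
  proof -
    have "(\<Sum>u\<in>V. ((if v = u then real (card {w \<in> V. E v w}) + e v else 0)
            - (if E v u then 1 else 0)) * f u)
        = (\<Sum>u\<in>V. (if v = u then (real (card {w \<in> V. E v w}) + e v) * f u else 0))
          - (\<Sum>u\<in>V. if E v u then f u else 0)"
      unfolding sum_subtractf[symmetric] by (intro sum.cong) (auto simp: algebra_simps)
    also have "(\<Sum>u\<in>V. (if v = u then (real (card {w \<in> V. E v w}) + e v) * f u else 0))
        = (real (card {w \<in> V. E v w}) + e v) * f v"
      using V v by simp
    finally have row: "(\<Sum>u\<in>V. ((if v = u then real (card {w \<in> V. E v w}) + e v else 0)
            - (if E v u then 1 else 0)) * f u)
        = (real (card {w \<in> V. E v w}) + e v) * f v - (\<Sum>u\<in>V. if E v u then f u else 0)" .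
    have "f v * (\<Sum>u\<in>V. ((if v = u then real (card {w \<in> V. E v w}) + e v else 0)
            - (if E v u then 1 else 0)) * f u)
        = real (card {w \<in> V. E v w}) * (f v)\<^sup>2 - f v * (\<Sum>u\<in>V. if E v u then f u else 0) + e v * (f v)\<^sup>2"
      unfolding row by (simp add: power2_eq_square algebra_simps)
    moreover have "real (card {w \<in> V. E v w}) * c = (\<Sum>u\<in>V. if E v u then c else 0)" for c
      using V by (simp add: sum.If_cases Int_def)
    moreover have "f v * (\<Sum>u\<in>V. if E v u then f u else 0) = (\<Sum>u\<in>V. if E v u then f v * f u else 0)"
      unfolding sum_distrib_left by (intro sum.cong) auto
    ultimately show ?thesis by simp
  qed
  have 2: "?S (\<lambda>v u. (f u)\<^sup>2) = ?S (\<lambda>v u. (f v)\<^sup>2)"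
    by (subst sum.swap) (auto intro!: sum.cong dest: sympD[OF sym])
  have "?S (\<lambda>v u. (f v - f u)\<^sup>2)
      = ?S (\<lambda>v u. (f v)\<^sup>2) + ?S (\<lambda>v u. (f u)\<^sup>2) - 2 * ?S (\<lambda>v u. f v * f u)"
    unfolding sum.distrib[symmetric] sum_subtractf[symmetric] sum_distrib_left
    by (intro sum.cong refl) (auto simp: power2_eq_square algebra_simps)
  hence "dirichlet_form V E f = ?S (\<lambda>v u. (f v)\<^sup>2) - ?S (\<lambda>v u. f v * f u)"
    using 2 by (simp add: dirichlet_form_def)
  thus ?thesis
    by (simp add: 1 sum.distrib sum_subtractf cong: sum.cong)
qed

lemma dirichlet_form_zero_imp_constant:
  assumes V: "finite V" and 0: "dirichlet_form V E f = 0"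
    and conn: "(u, v) \<in> {(u, v). u \<in> V \<and> v \<in> V \<and> E u v}\<^sup>*"
  shows "f u = f v"
  using conn
proof (induction rule: rtrancl_induct)
  case (step x y)
  have "(\<Sum>v\<in>V. \<Sum>u\<in>V. if E v u then (f v - f u)\<^sup>2 else 0) = 0"
    using 0 by (simp add: dirichlet_form_def)
  hence "\<forall>v\<in>V. (\<Sum>u\<in>V. if E v u then (f v - f u)\<^sup>2 else 0) = 0"
    using V by (subst (asm) sum_nonneg_eq_0_iff) (auto intro!: sum_nonneg)
  hence "\<forall>v\<in>V. \<forall>u\<in>V. (if E v u then (f v - f u)\<^sup>2 else 0) = 0"
    using V by (subst (asm) sum_nonneg_eq_0_iff) auto
  hence "(f x - f y)\<^sup>2 = 0" using step by (metis (mono_tags, lifting) mem_Collect_eq case_prodD)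
  thus ?case using step by simp
qed simp

text \<open>
  The kernel of the Laplacian of the graph \<open>(V, E)\<close> plus the multiplication operator by \<open>e\<close>. Taking
  \<open>e = 0\<close> gives the Laplacian itself; taking for \<open>e v\<close> the number of neighbours of \<open>v\<close> in the grounded
  set gives the grounded Laplacian.
\<close>
definition potential_laplacian ::
  "'v set \<Rightarrow> ('v \<Rightarrow> 'v \<Rightarrow> bool) \<Rightarrow> ('v \<Rightarrow> real) \<Rightarrow> 'v \<Rightarrow> 'v \<Rightarrow> real" where
  "potential_laplacian V E e v u =
     (if v = u then real (card {w \<in> V. E v w}) + e v else 0) - (if E v u then 1 else 0)"

lemma potential_laplacian_cong:
  assumes "\<And>u v. u \<in> V \<Longrightarrow> v \<in> V \<Longrightarrow> E u v \<longleftrightarrow> E' u v" "u \<in> V" "v \<in> V"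
  shows "potential_laplacian V E e u v = potential_laplacian V E' e u v"
proof -
  have "{w \<in> V. E x w} = {w \<in> V. E' x w}" if "x \<in> V" for x using assms that by blast
  thus ?thesis using assms by (simp add: potential_laplacian_def)
qed

section \<open>Eigenvalues in terms of functions on the vertices\<close>

text \<open>
  The rows of a Laplacian and of a grounded Laplacian are enumerated in ways that need not be related.
  Every statement about matrices is therefore turned into one about functions on the vertices, where the
  enumeration \<open>\<phi>\<close> has disappeared.
\<close>
lemma quadratic_form_reindex:
  fixes a :: "'v \<Rightarrow> 'v \<Rightarrow> real"
  assumes "bij_betw \<phi> {0..<n} V"
  shows "vec n (f \<circ> \<phi>) \<bullet> vec n (g \<circ> \<phi>) = (\<Sum>v\<in>V. f v * g v)"
    and "mat n n (\<lambda>(i, j). a (\<phi> i) (\<phi> j)) *\<^sub>v vec n (f \<circ> \<phi>) = vec n ((\<lambda>v. \<Sum>u\<in>V. a v u * f u) \<circ> \<phi>)"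
proof -
  have re: "(\<Sum>i = 0..<n. h (\<phi> i)) = (\<Sum>v\<in>V. h v)" for h :: "'v \<Rightarrow> real"
    using sum.reindex_bij_betw[OF assms] .
  show "vec n (f \<circ> \<phi>) \<bullet> vec n (g \<circ> \<phi>) = (\<Sum>v\<in>V. f v * g v)"
    using re[of "\<lambda>v. f v * g v"] by (simp add: scalar_prod_def)
  show "mat n n (\<lambda>(i, j). a (\<phi> i) (\<phi> j)) *\<^sub>v vec n (f \<circ> \<phi>) = vec n ((\<lambda>v. \<Sum>u\<in>V. a v u * f u) \<circ> \<phi>)"
  proof (rule eq_vecI)
    fix i assume "i < dim_vec (vec n ((\<lambda>v. \<Sum>u\<in>V. a v u * f u) \<circ> \<phi>))"
    thus "(mat n n (\<lambda>(i, j). a (\<phi> i) (\<phi> j)) *\<^sub>v vec n (f \<circ> \<phi>)) $ i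
        = vec n ((\<lambda>v. \<Sum>u\<in>V. a v u * f u) \<circ> \<phi>) $ i"
      using re[of "\<lambda>u. a (\<phi> i) u * f u"] by (simp add: scalar_prod_def)
  qed simp
qed

lemma vec_reindex:
  assumes "bij_betw \<phi> {0..<n} V" "x \<in> carrier_vec n"
  obtains f where "x = vec n (f \<circ> \<phi>)"
proof
  show "x = vec n ((\<lambda>v. x $ the_inv_into {0..<n} \<phi> v) \<circ> \<phi>)"
    using assms by (auto simp: bij_betw_def the_inv_into_f_f)
qed

lemma norm_reindex:
  assumes "bij_betw \<phi> {0..<n} V"
  shows "vec n (f \<circ> \<phi>) \<bullet> vec n (f \<circ> \<phi>) = (\<Sum>v\<in>V. (f v :: real)\<^sup>2)"
  unfolding quadratic_form_reindex(1)[OF assms] by (simp add: power2_eq_square)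

lemma potential_laplacian_mat:
  fixes \<phi> :: "nat \<Rightarrow> 'v" and e :: "'v \<Rightarrow> real"
  assumes \<phi>: "bij_betw \<phi> {0..<n} V" and sym: "symp E"
  defines "A \<equiv> mat n n (\<lambda>(i, j). potential_laplacian V E e (\<phi> i) (\<phi> j))"
  shows "A \<in> carrier_mat n n" and "A\<^sup>T = A"
    and "vec n (f \<circ> \<phi>) \<bullet> (A *\<^sub>v vec n (f \<circ> \<phi>)) = dirichlet_form V E f + (\<Sum>v\<in>V. e v * (f v)\<^sup>2)"
proof -
  have V: "finite V" using \<phi> bij_betw_finite by blast
  show "A \<in> carrier_mat n n" by (simp add: A_def)
  show "A\<^sup>T = A"
    by (rule eq_matI) (auto simp: A_def potential_laplacian_def dest: sympD[OF sym])
  show "vec n (f \<circ> \<phi>) \<bullet> (A *\<^sub>v vec n (f \<circ> \<phi>)) = dirichlet_form V E f + (\<Sum>v\<in>V. e v * (f v)\<^sup>2)"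
    unfolding A_def quadratic_form_reindex(2)[OF \<phi>, of "potential_laplacian V E e"]
      quadratic_form_reindex(1)[OF \<phi>]
    unfolding potential_laplacian_def
    by (rule dirichlet_form_eq[OF V sym])
qed

lemma smallest_eigenvalue_potential_laplacian:
  fixes \<phi> :: "nat \<Rightarrow> 'v" and e :: "'v \<Rightarrow> real"
  assumes \<phi>: "bij_betw \<phi> {0..<n} V" and sym: "symp E" and n: "n > 0"
  defines "t \<equiv> smallest_eigenvalue (mat n n (\<lambda>(i, j). potential_laplacian V E e (\<phi> i) (\<phi> j)))"
  shows "t * (\<Sum>v\<in>V. (f v)\<^sup>2) \<le> dirichlet_form V E f + (\<Sum>v\<in>V. e v * (f v)\<^sup>2)"
    and "\<exists>f. (\<Sum>v\<in>V. (f v)\<^sup>2) > 0 \<and>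
           t * (\<Sum>v\<in>V. (f v)\<^sup>2) = dirichlet_form V E f + (\<Sum>v\<in>V. e v * (f v)\<^sup>2)"
proof -
  note A = potential_laplacian_mat[where E = E and e = e, OF \<phi> sym]
  note ray = smallest_eigenvalue_Rayleigh[OF A(1,2) n, folded t_def]
  show "t * (\<Sum>v\<in>V. (f v)\<^sup>2) \<le> dirichlet_form V E f + (\<Sum>v\<in>V. e v * (f v)\<^sup>2)"
    using ray(2)[of "vec n (f \<circ> \<phi>)"] by (simp only: A(3) norm_reindex[OF \<phi>] vec_carrier)
  obtain x where x: "x \<in> carrier_vec n" "x \<bullet> x > 0"
    "x \<bullet> (mat n n (\<lambda>(i, j). potential_laplacian V E e (\<phi> i) (\<phi> j)) *\<^sub>v x) = t * (x \<bullet> x)"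
    using eigenvector_quadratic_form[OF A(1) ray(1)] by blast
  obtain g where "x = vec n (g \<circ> \<phi>)" using vec_reindex[OF \<phi> x(1)] .
  hence "(\<Sum>v\<in>V. (g v)\<^sup>2) > 0 \<and> t * (\<Sum>v\<in>V. (g v)\<^sup>2) = dirichlet_form V E g + (\<Sum>v\<in>V. e v * (g v)\<^sup>2)"
    using x(2,3) by (simp only: A(3) norm_reindex[OF \<phi>])
  thus "\<exists>f. (\<Sum>v\<in>V. (f v)\<^sup>2) > 0 \<and>
           t * (\<Sum>v\<in>V. (f v)\<^sup>2) = dirichlet_form V E f + (\<Sum>v\<in>V. e v * (f v)\<^sup>2)" by (intro exI)
qed

text \<open>
  Functions of sum zero are those orthogonal to the kernel vector of the Laplacian. The value \<open>\<mu>\<close> is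
  positive because it is attained at some nonzero function of sum zero: were the Dirichlet form zero
  there, this function would be constant by connectedness.
\<close>
lemma second_smallest_eigenvalue_laplacian:
  fixes \<phi> :: "nat \<Rightarrow> 'v"
  assumes \<phi>: "bij_betw \<phi> {0..<n} V" and sym: "symp E" and n: "n \<ge> 2"
    and conn: "\<And>u v. u \<in> V \<Longrightarrow> v \<in> V \<Longrightarrow> (u, v) \<in> {(u, v). u \<in> V \<and> v \<in> V \<and> E u v}\<^sup>*"
  defines "\<mu> \<equiv> second_smallest_eigenvalue (mat n n (\<lambda>(i, j). potential_laplacian V E (\<lambda>_. 0) (\<phi> i) (\<phi> j)))"
  shows "(\<Sum>v\<in>V. f v) = 0 \<Longrightarrow> \<mu> * (\<Sum>v\<in>V. (f v)\<^sup>2) \<le> dirichlet_form V E f" and "\<mu> > 0"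
proof -
  have V: "finite V" using \<phi> bij_betw_finite by blast
  have cV: "card V = n" using bij_betw_same_card[OF \<phi>] by simp
  define A where "A = mat n n (\<lambda>(i, j). potential_laplacian V E (\<lambda>_. 0) (\<phi> i) (\<phi> j))"
  note A = potential_laplacian_mat[where E = E and e = "\<lambda>_. 0", OF \<phi> sym, folded A_def]
  have form: "vec n (f \<circ> \<phi>) \<bullet> (A *\<^sub>v vec n (f \<circ> \<phi>)) = dirichlet_form V E f" for f
    unfolding A(3) by simp
  have psd: "0 \<le> x \<bullet> (A *\<^sub>v x)" if x: "x \<in> carrier_vec n" for x
  proof -
    obtain g where "x = vec n (g \<circ> \<phi>)" using vec_reindex[OF \<phi> x] .
    thus ?thesis by (simp only: form dirichlet_form_nonneg)
  qed
  define k where "k = 1 / sqrt (real n)"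
  have k: "k > 0" "k\<^sup>2 = 1 / real n" using n by (simp_all add: k_def power_divide)
  define u where "u = vec n ((\<lambda>_. k) \<circ> \<phi>)"
  have u: "u \<in> carrier_vec n" "u \<bullet> u = 1"
    unfolding u_def norm_reindex[OF \<phi>] using n k cV by auto
  have Au: "A *\<^sub>v u = 0\<^sub>v n"
  proof -
    have "(\<Sum>w\<in>V. potential_laplacian V E (\<lambda>_. 0) v w * k) = 0" if "v \<in> V" for v
    proof -
      have "real (card {w \<in> V. E v w}) = (\<Sum>u\<in>V. if E v u then 1 else 0)"
        using V by (simp add: sum.If_cases Int_def)
      thus ?thesis
        using V that by (simp add: potential_laplacian_def sum_subtractf flip: sum_distrib_right)
    qed
    thus ?thesis
      unfolding A_def u_def quadratic_form_reindex(2)[OF \<phi>, of "potential_laplacian V E (\<lambda>_. 0)"]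
      using bij_betwE[OF \<phi>] by (intro eq_vecI) auto
  qed
  have orth: "vec n (f \<circ> \<phi>) \<bullet> u = k * (\<Sum>v\<in>V. f v)" for f
    unfolding u_def quadratic_form_reindex(1)[OF \<phi>] by (simp add: sum_distrib_left mult.commute)
  note ray = second_smallest_eigenvalue_Rayleigh[OF A(1,2) n psd u Au]
  have \<mu>: "\<mu> = second_smallest_eigenvalue A" by (simp add: \<mu>_def A_def)
  show "\<mu> * (\<Sum>v\<in>V. (f v)\<^sup>2) \<le> dirichlet_form V E f" if "(\<Sum>v\<in>V. f v) = 0"
    using ray(1)[of "vec n (f \<circ> \<phi>)"] that unfolding form orth norm_reindex[OF \<phi>] \<mu> by simp
  obtain y where y: "y \<in> carrier_vec n" "y \<bullet> u = 0" "y \<bullet> y > 0" "y \<bullet> (A *\<^sub>v y) = \<mu> * (y \<bullet> y)"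
    using ray(2) unfolding \<mu> by blast
  obtain g where g: "y = vec n (g \<circ> \<phi>)" using vec_reindex[OF \<phi> y(1)] .
  have g0: "(\<Sum>v\<in>V. g v) = 0" using y(2) k unfolding g orth by simp
  have gg: "(\<Sum>v\<in>V. (g v)\<^sup>2) > 0" using y(3) unfolding g norm_reindex[OF \<phi>] .
  have D: "dirichlet_form V E g = \<mu> * (\<Sum>v\<in>V. (g v)\<^sup>2)" using y(4) unfolding g form norm_reindex[OF \<phi>] .
  have "dirichlet_form V E g \<noteq> 0"
  proof
    assume "dirichlet_form V E g = 0"
    from dirichlet_form_zero_imp_constant[OF V this] conn
    have const: "g a = g b" if "a \<in> V" "b \<in> V" for a b using that by blast
    obtain w where w: "w \<in> V" using cV n by fastforce
    have "(\<Sum>v\<in>V. g v) = (\<Sum>v\<in>V. g w)" by (intro sum.cong refl const w)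
    hence "g w = 0" using g0 cV n by simp
    hence "g v = 0" if "v \<in> V" for v using const[OF that w] by simp
    hence "(\<Sum>v\<in>V. (g v)\<^sup>2) = 0" by simp
    thus False using gg by simp
  qed
  hence "dirichlet_form V E g > 0" using dirichlet_form_nonneg[of V E g] by linarith
  hence "\<mu> * (\<Sum>v\<in>V. (g v)\<^sup>2) > 0" unfolding D .
  thus "\<mu> > 0" using gg by (rule zero_less_mult_pos2)
qed

section \<open>Bounding the ground state energy of a weak potential\<close>

text \<open>
  The analytic core: a minimizer is compared with its mean. The form \<open>D\<close> enters through its invariance
  under adding constants and its spectral gap \<open>\<mu>\<close> above them. The assumptions \<open>ray\<close> and \<open>att\<close> say that \<open>t\<close> is the minimum of the Rayleigh quotient of \<open>D\<close>
  perturbed by the potential \<open>e\<close>.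
\<close>
lemma ground_eigenvalue_bounds:
  fixes D :: "('v \<Rightarrow> real) \<Rightarrow> real"
  assumes V: "finite V" "V \<noteq> {}"
    and D_nonneg: "\<And>f. 0 \<le> D f" and D_const: "\<And>c. D (\<lambda>_. c) = 0"
    and D_shift: "\<And>f c. D (\<lambda>v. f v + c) = D f"
    and e: "\<And>v. v \<in> V \<Longrightarrow> 0 \<le> e v" "\<And>v. v \<in> V \<Longrightarrow> e v \<le> d"
    and \<mu>: "\<mu> > 0" "\<And>f. (\<Sum>v\<in>V. f v) = 0 \<Longrightarrow> \<mu> * (\<Sum>v\<in>V. (f v)\<^sup>2) \<le> D f"
    and ray: "\<And>f. t * (\<Sum>v\<in>V. (f v)\<^sup>2) \<le> D f + (\<Sum>v\<in>V. e v * (f v)\<^sup>2)"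
    and att: "(\<Sum>v\<in>V. (f v)\<^sup>2) > 0" "t * (\<Sum>v\<in>V. (f v)\<^sup>2) = D f + (\<Sum>v\<in>V. e v * (f v)\<^sup>2)"
  shows "t \<le> (\<Sum>v\<in>V. e v) / card V"
    and "(1 - 2 * (d / \<mu>)) * ((\<Sum>v\<in>V. e v) / card V) \<le> t"
proof -
  define m where "m = real (card V)"
  define b where "b = (\<Sum>v\<in>V. e v)"
  define N where "N = (\<Sum>v\<in>V. (f v)\<^sup>2)"
  have m: "m > 0" using V by (simp add: m_def card_gt_0_iff)
  have "t * m \<le> b" using ray[of "\<lambda>_. 1"] D_const by (simp add: m_def b_def)
  hence upper: "t \<le> b / m" using m by (simp add: field_simps)
  thus "t \<le> (\<Sum>v\<in>V. e v) / card V" by (simp add: m_def b_def)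
  have b0: "b \<ge> 0" using e by (auto simp: b_def intro!: sum_nonneg)
  have "b \<le> m * d" using e sum_bounded_above[of V e d] by (simp add: b_def m_def)
  hence avg: "b / m \<le> d" using m by (simp add: field_simps)
  have d0: "d \<ge> 0" using avg b0 m by (meson divide_nonneg_pos order_trans)
  have N: "N > 0" and tN: "t * N = D f + (\<Sum>v\<in>V. e v * (f v)\<^sup>2)"
    using att by (auto simp: N_def)
  have e_nonneg: "(\<Sum>v\<in>V. e v * (g v)\<^sup>2) \<ge> 0" for g
    using e by (intro sum_nonneg) simp
  have t0: "t \<ge> 0"
  proof -
    have "0 \<le> t * N" using tN D_nonneg[of f] e_nonneg[of f] by simp
    thus ?thesis using N by (simp add: zero_le_mult_iff)
  qed
  define r where "r = d / \<mu>"
  have r0: "r \<ge> 0" using d0 \<mu> by (simp add: r_def)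
  have "(1 - 2 * r) * (b / m) \<le> t"
  proof (cases "r \<le> 1")
    case False
    hence "(1 - 2 * r) * (b / m) \<le> 0" using b0 m by (intro mult_nonpos_nonneg) auto
    thus ?thesis using t0 by simp
  next
    case True
    define c where "c = (\<Sum>v\<in>V. f v) / m"
    define y where "y v = f v - c" for v
    define T where "T = (\<Sum>v\<in>V. (y v)\<^sup>2)"
    have f: "f v = y v + c" for v by (simp add: y_def)
    have y0: "(\<Sum>v\<in>V. y v) = 0"
      using m by (simp add: y_def sum_subtractf c_def m_def)
    have "N = T + m * c\<^sup>2"
      using y0 by (simp add: N_def T_def f power2_sum sum.distrib m_def algebra_simps
          flip: sum_distrib_left sum_distrib_right)
    hence mc: "m * c\<^sup>2 = N - T" by simp
    have T0: "T \<ge> 0" by (auto simp: T_def intro: sum_nonneg)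
    have DT: "\<mu> * T \<le> D f"
      using \<mu>(2)[OF y0] D_shift[of y c] by (simp add: T_def f[symmetric])
    \<comment> \<open>The energy of a minimizer is at most that of a constant, so \<open>f\<close> is close to its mean.\<close>
    have "\<mu> * T \<le> t * N" using DT tN e_nonneg[of f] by simp
    also have "\<dots> \<le> d * N" using upper avg N by (intro mult_right_mono) auto
    finally have T: "T \<le> r * N" using \<mu>(1) by (simp add: r_def field_simps)
    define s where "s = (\<Sum>v\<in>V. e v * y v)"
    \<comment> \<open>The deviation \<open>y\<close> meets the potential through \<open>s\<close>, which is controlled by its norm.\<close>
    have "s\<^sup>2 \<le> (\<Sum>v\<in>V. (e v)\<^sup>2) * T"
      unfolding s_def T_def by (rule Cauchy_Schwarz_sum)
    also have "\<dots> \<le> (d * b) * T"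
    proof (rule mult_right_mono[OF _ T0])
      have "(\<Sum>v\<in>V. (e v)\<^sup>2) \<le> (\<Sum>v\<in>V. d * e v)"
        using e by (intro sum_mono) (simp add: power2_eq_square mult_right_mono)
      thus "(\<Sum>v\<in>V. (e v)\<^sup>2) \<le> d * b" by (simp add: b_def sum_distrib_left)
    qed
    finally have s: "s\<^sup>2 \<le> r * b * (\<mu> * T)" using \<mu>(1) by (simp add: r_def)
    have "(\<Sum>v\<in>V. e v * (f v)\<^sup>2) = (\<Sum>v\<in>V. e v * (y v)\<^sup>2) + 2 * c * s + c\<^sup>2 * b"
      by (simp add: f power2_sum algebra_simps sum.distrib s_def b_def sum_distrib_left sum_distrib_right)
    hence "t * N \<ge> \<mu> * T + 2 * c * s + c\<^sup>2 * b"
      using tN DT e_nonneg[of y] by simp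
    moreover have "- (2 * c * s) \<le> \<mu> * T + r * b * c\<^sup>2"
    proof -
      have "(2 * c * s)\<^sup>2 \<le> 4 * c\<^sup>2 * (r * b * (\<mu> * T))"
        using mult_left_mono[OF s, of "4 * c\<^sup>2"] by (simp add: power_mult_distrib)
      \<comment> \<open>The inequality \<open>4 p q \<le> (p + q)\<^sup>2\<close> for \<open>p = \<mu> T\<close> and \<open>q = r b c\<^sup>2\<close>.\<close>
      also have "\<dots> \<le> (\<mu> * T + r * b * c\<^sup>2)\<^sup>2"
        using sum_squares_ge_zero[of "\<mu> * T - r * b * c\<^sup>2" 0]
        by (simp add: power2_eq_square algebra_simps)
      finally show ?thesis
        using abs_le_square_iff[of "2 * c * s" "\<mu> * T + r * b * c\<^sup>2"] \<mu>(1) T0 r0 b0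
        by (simp add: abs_le_iff)
    qed
    ultimately have 1: "(1 - r) * (c\<^sup>2 * b) \<le> t * N" by (simp add: algebra_simps)
    have "(1 - r) * N \<le> m * c\<^sup>2" using mc T by (simp add: algebra_simps)
    hence "(1 - r) * N / m \<le> c\<^sup>2" using m by (simp add: field_simps)
    hence "(1 - r) * ((1 - r) * N / m * b) \<le> (1 - r) * (c\<^sup>2 * b)"
      using True b0 by (intro mult_left_mono mult_right_mono) auto
    moreover have "(1 - r) * ((1 - r) * N / m * b) = ((1 - r)\<^sup>2 * (b / m)) * N"
      by (simp add: power2_eq_square)
    ultimately have "((1 - r)\<^sup>2 * (b / m)) * N \<le> t * N"
      using 1 by linarith
    hence "(1 - r)\<^sup>2 * (b / m) \<le> t" using N by (rule mult_right_le_imp_le)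
    moreover have "(1 - 2 * r) * (b / m) \<le> (1 - r)\<^sup>2 * (b / m)"
      using b0 m by (intro mult_right_mono) (auto simp: power2_eq_square algebra_simps)
    ultimately show ?thesis by simp
  qed
  thus "(1 - 2 * (d / \<mu>)) * ((\<Sum>v\<in>V. e v) / card V) \<le> t"
    by (simp add: r_def b_def m_def)
qed

section \<open>Laplacians of graphs\<close>

lemma (in nomulti_digraph) out_degree_eq_card_neighbours:
  "out_degree G v = card {u \<in> verts G. v \<rightarrow>\<^bsub>G\<^esub> u}"
proof -
  have "inj_on (head G) (out_arcs G v)"
    by (rule inj_onI) (auto simp: arc_to_ends_def intro: no_multi_arcs)
  hence "card (head G ` out_arcs G v) = out_degree G v"
    by (simp add: out_degree_def card_image)
  also have "head G ` out_arcs G v = {u \<in> verts G. v \<rightarrow>\<^bsub>G\<^esub> u}"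
    by (auto simp: arcs_ends_conv image_iff)
  finally show ?thesis ..
qed

lemma bij_betw_vertex_at:
  assumes "finite (verts G)"
  shows "bij_betw (vertex_at G) {0..<card (verts G)} (verts G)"
proof -
  let ?l = "sorted_list_of_set (verts G)"
  have "bij_betw ((!) ?l) {..<length ?l} (set ?l)"
    by (rule bij_betw_nth) auto
  thus ?thesis
    using assms by (simp add: vertex_at_def[abs_def] lessThan_atLeast0)
qed

lemma laplacian_eq_potential_laplacian:
  assumes G: "nomulti_digraph G" and fin: "finite (verts G)"
  shows "laplacian G = mat (card (verts G)) (card (verts G))
    (\<lambda>(i, j). potential_laplacian (verts G) (dominates G) (\<lambda>_. 0) (vertex_at G i) (vertex_at G j))"
proof (rule eq_matI)
  have inj: "vertex_at G i = vertex_at G j \<longleftrightarrow> i = j" if "i < card (verts G)" "j < card (verts G)" for i j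
    using bij_betw_imp_inj_on[OF bij_betw_vertex_at[OF fin]] that by (auto simp: inj_on_def)
  fix i j
  assume "i < dim_row (mat (card (verts G)) (card (verts G)) (\<lambda>(i, j).
    potential_laplacian (verts G) (dominates G) (\<lambda>_. 0) (vertex_at G i) (vertex_at G j)))"
    and "j < dim_col (mat (card (verts G)) (card (verts G)) (\<lambda>(i, j).
    potential_laplacian (verts G) (dominates G) (\<lambda>_. 0) (vertex_at G i) (vertex_at G j)))"
  thus "laplacian G $$ (i, j) = mat (card (verts G)) (card (verts G)) (\<lambda>(i, j).
    potential_laplacian (verts G) (dominates G) (\<lambda>_. 0) (vertex_at G i) (vertex_at G j)) $$ (i, j)"
    using inj[of i j]
    by (simp add: laplacian_def degree_matrix_def adjacency_matrix_def potential_laplacian_def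
        nomulti_digraph.out_degree_eq_card_neighbours[OF G])
qed (auto simp: laplacian_def degree_matrix_def adjacency_matrix_def)

lemma bij_betw_pick:
  assumes "finite I"
  shows "bij_betw (pick I) {0..<card I} I"
proof (rule bij_betwI)
  show "pick I \<in> {0..<card I} \<rightarrow> I" using pick_in_set by auto
  show "(\<lambda>i. card {a \<in> I. a < i}) \<in> I \<rightarrow> {0..<card I}"
    using assms by (auto intro!: psubset_card_mono)
  show "card {a \<in> I. a < pick I k} = k" if "k \<in> {0..<card I}" for k
    using that card_pick by simp
  show "pick I (card {a \<in> I. a < i}) = i" if "i \<in> I" for i
    using that by (rule pick_card_in_set)
qed

text \<open>
  Deleting the grounded rows and columns leaves the full degrees on the diagonal. The degree of a
  remaining vertex splits into its degree in the induced subgraph and its number of grounded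
  neighbours, which becomes the potential.
\<close>
lemma grounded_laplacian_eq_potential_laplacian:
  assumes G: "nomulti_digraph G" and fin: "finite (verts G)" and S: "S \<subseteq> verts G"
  obtains \<phi> where "bij_betw \<phi> {0..<card (verts G - S)} (verts G - S)"
    and "grounded_laplacian G S = mat (card (verts G - S)) (card (verts G - S))
      (\<lambda>(i, j). potential_laplacian (verts G - S) (dominates G)
         (\<lambda>v. real (card {u \<in> S. v \<rightarrow>\<^bsub>G\<^esub> u})) (\<phi> i) (\<phi> j))"
proof -
  let ?n = "card (verts G)" and ?W = "verts G - S"
  define I where "I = {i. i < ?n \<and> vertex_at G i \<notin> S}"
  note bij = bij_betw_vertex_at[OF fin]
  have I: "finite I" "I \<subseteq> {0..<?n}" by (auto simp: I_def)
  have "vertex_at G ` I = vertex_at G ` {0..<?n} - S" by (auto simp: I_def)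
  also have "vertex_at G ` {0..<?n} = verts G" using bij by (rule bij_betw_imp_surj_on)
  finally have "vertex_at G ` I = ?W" .
  hence bI: "bij_betw (vertex_at G) I ?W"
    using bij_betw_subset[OF bij I(2)] by simp
  hence cI: "card I = card ?W" by (rule bij_betw_same_card)
  define \<phi> where "\<phi> = vertex_at G \<circ> pick I"
  have \<phi>: "bij_betw \<phi> {0..<card ?W} ?W"
    unfolding \<phi>_def using bij_betw_trans[OF bij_betw_pick[OF I(1)] bI] by (simp add: cI)
  have deg: "real (card {w \<in> verts G. v \<rightarrow>\<^bsub>G\<^esub> w})
      = real (card {w \<in> ?W. v \<rightarrow>\<^bsub>G\<^esub> w}) + real (card {u \<in> S. v \<rightarrow>\<^bsub>G\<^esub> u})" for v
  proof -
    have "{w \<in> verts G. v \<rightarrow>\<^bsub>G\<^esub> w} = {w \<in> ?W. v \<rightarrow>\<^bsub>G\<^esub> w} \<union> {u \<in> S. v \<rightarrow>\<^bsub>G\<^esub> u}"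
      using S by auto
    moreover have "card ({w \<in> ?W. v \<rightarrow>\<^bsub>G\<^esub> w} \<union> {u \<in> S. v \<rightarrow>\<^bsub>G\<^esub> u})
        = card {w \<in> ?W. v \<rightarrow>\<^bsub>G\<^esub> w} + card {u \<in> S. v \<rightarrow>\<^bsub>G\<^esub> u}"
      using fin finite_subset[OF S fin] by (intro card_Un_disjoint) auto
    ultimately show ?thesis by simp
  qed
  have K: "potential_laplacian (verts G) (dominates G) (\<lambda>_. 0) v u = potential_laplacian ?W (dominates G)
         (\<lambda>v. real (card {u \<in> S. v \<rightarrow>\<^bsub>G\<^esub> u})) v u" for v u
    unfolding potential_laplacian_def deg by simp
  have dims: "{i. i < ?n \<and> i \<in> I} = I" using I by auto
  have pick: "pick I i < ?n" if "i < card ?W" for i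
    using pick_in_set[of i I] that I(2) by (auto simp: cI)
  have "grounded_laplacian G S = mat (card ?W) (card ?W)
      (\<lambda>(i, j). potential_laplacian ?W (dominates G)
         (\<lambda>v. real (card {u \<in> S. v \<rightarrow>\<^bsub>G\<^esub> u})) (\<phi> i) (\<phi> j))"
    unfolding grounded_laplacian_def Let_def I_def[symmetric]
    unfolding laplacian_eq_potential_laplacian[OF G fin] submatrix_def
    by (rule eq_matI) (simp_all add: dims cI pick \<phi>_def K)
  thus thesis using that \<phi> by blast
qed

text \<open>
  A boundary edge has exactly one non-grounded endpoint, so grouping the boundary by this endpoint
  counts every edge once.
\<close>
lemma card_edge_boundary:
  assumes fin: "finite (verts G)" and S: "S \<subseteq> verts G" and sym: "symmetric G"
  shows "card (edge_boundary G S) = (\<Sum>v\<in>verts G - S. card {u \<in> S. v \<rightarrow>\<^bsub>G\<^esub> u})"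
proof -
  let ?P = "SIGMA v:verts G - S. {u \<in> S. v \<rightarrow>\<^bsub>G\<^esub> u}"
  have "edge_boundary G S = (\<lambda>(v, u). {u, v}) ` ?P"
    using arcs_ends_symmetric[OF sym] by (auto simp: edge_boundary_def image_iff)
  moreover have "inj_on (\<lambda>(v, u). {u, v}) ?P"
    by (auto simp: inj_on_def doubleton_eq_iff)
  ultimately have "card (edge_boundary G S) = card ?P"
    by (simp add: card_image)
  also have "\<dots> = (\<Sum>v\<in>verts G - S. card {u \<in> S. v \<rightarrow>\<^bsub>G\<^esub> u})"
    using fin finite_subset[OF S fin] by (intro card_SigmaI) auto
  finally show ?thesis .
qed

lemma laplacian_induce_subgraph:
  assumes G: "nomulti_digraph G" and W: "finite W"
  shows "laplacian (G \<restriction> W) = mat (card W) (card W) (\<lambda>(i, j).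
    potential_laplacian W (dominates G) (\<lambda>_. 0) (vertex_at (G \<restriction> W) i) (vertex_at (G \<restriction> W) j))"
proof -
  interpret nomulti_digraph G by fact
  let ?H = "G \<restriction> W" and ?n = "card W"
  have "nomulti_digraph ?H"
    by (intro nomulti_digraph.intro wellformed_induce_subgraph nomulti_digraph_axioms.intro)
       (auto intro: no_multi_arcs)
  hence "laplacian ?H = mat ?n ?n
      (\<lambda>(i, j). potential_laplacian W (dominates ?H) (\<lambda>_. 0) (vertex_at ?H i) (vertex_at ?H j))"
    using laplacian_eq_potential_laplacian[of ?H] W by simp
  also have "\<dots> = mat ?n ?n
      (\<lambda>(i, j). potential_laplacian W (dominates G) (\<lambda>_. 0) (vertex_at ?H i) (vertex_at ?H j))"
  proof (rule cong_mat, goal_cases)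
    case (3 i j)
    hence "vertex_at ?H i \<in> W" "vertex_at ?H j \<in> W"
      using bij_betwE[OF bij_betw_vertex_at[of ?H]] W by auto
    moreover have "u \<rightarrow>\<^bsub>?H\<^esub> v \<longleftrightarrow> u \<rightarrow>\<^bsub>G\<^esub> v" if "u \<in> W" "v \<in> W" for u v
      using that by (auto simp: arcs_ends_conv)
    ultimately show ?case
      using potential_laplacian_cong[of W "dominates ?H" "dominates G"] by auto
  qed auto
  finally show ?thesis .
qed

section \<open>The smallest eigenvalue of the grounded Laplacian\<close>

text \<open>
  The bounds for one graph. With \<open>d = sqrt (\<bar>S\<bar> * \<bar>\<partial>S\<bar>)\<close> as a bound for the potential, the quotient
  \<open>d / \<mu>\<close> is \<open>\<rho>\<close>.
\<close>
lemma grounded_laplacian_eigenvalue_bounds: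
  fixes G :: "('a::linorder, 'b) pre_digraph"
  assumes G: "graph G" and S: "S \<subseteq> verts G"
    and conn: "Digraph_Component.connected (G \<restriction> (verts G - S))" and card: "card (verts G - S) \<ge> 2"
  defines "\<rho> \<equiv> sqrt (real (card S) * real (card (edge_boundary G S)))
      / second_smallest_eigenvalue (laplacian (G \<restriction> (verts G - S)))"
    and "\<tau> \<equiv> real (card (edge_boundary G S)) / (real (card (verts G)) - real (card S))"
  shows "smallest_eigenvalue (grounded_laplacian G S) \<le> \<tau>"
    and "(1 - 2 * \<rho>) * \<tau> \<le> smallest_eigenvalue (grounded_laplacian G S)"
proof -
  interpret graph G by fact
  let ?W = "verts G - S" and ?H = "G \<restriction> (verts G - S)" and ?E = "dominates G"
  define n where "n = card ?W"
  define e where "e v = real (card {u \<in> S. v \<rightarrow>\<^bsub>G\<^esub> u})" for v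
  define b where "b = card (edge_boundary G S)"
  have finS: "finite S" using finite_subset[OF S finite_verts] .
  have sym: "symp ?E"
    by (rule sympI) (rule arcs_ends_symmetric[OF sym_arcs])
  have Hends: "u \<rightarrow>\<^bsub>?H\<^esub> v \<longleftrightarrow> u \<in> ?W \<and> v \<in> ?W \<and> u \<rightarrow>\<^bsub>G\<^esub> v" for u v
    by (auto simp: arcs_ends_conv)
  have path: "(u, v) \<in> {(u, v). u \<in> ?W \<and> v \<in> ?W \<and> u \<rightarrow>\<^bsub>G\<^esub> v}\<^sup>*" if "u \<in> ?W" "v \<in> ?W" for u v
  proof -
    have "symcl (arcs_ends ?H) = {(u, v). u \<in> ?W \<and> v \<in> ?W \<and> u \<rightarrow>\<^bsub>G\<^esub> v}"
      using Hends sympD[OF sym] by (auto simp: symcl_def)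
    moreover have "(u, v) \<in> rtrancl_on (verts ?H) (symcl (arcs_ends ?H))"
      using conn that unfolding connected_conv induce_subgraph_verts by blast
    ultimately show ?thesis using rtrancl_on_rtranclI by metis
  qed

  obtain \<phi> where \<phi>: "bij_betw \<phi> {0..<n} ?W"
    "grounded_laplacian G S = mat n n (\<lambda>(i, j). potential_laplacian ?W ?E e (\<phi> i) (\<phi> j))"
    using grounded_laplacian_eq_potential_laplacian[OF nomulti_digraph finite_verts S]
    unfolding n_def e_def[abs_def] by blast
  define t where "t = smallest_eigenvalue (grounded_laplacian G S)"
  have "n > 0" using card unfolding n_def by linarith
  note small = smallest_eigenvalue_potential_laplacian[where E = ?E and e = e,
      OF \<phi>(1) sym this, folded \<phi>(2) t_def]
  obtain f where f: "(\<Sum>v\<in>?W. (f v)\<^sup>2) > 0"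
    "t * (\<Sum>v\<in>?W. (f v)\<^sup>2) = dirichlet_form ?W ?E f + (\<Sum>v\<in>?W. e v * (f v)\<^sup>2)"
    using small(2) by blast

  have lap: "laplacian ?H = mat n n
      (\<lambda>(i, j). potential_laplacian ?W ?E (\<lambda>_. 0) (vertex_at ?H i) (vertex_at ?H j))"
    using laplacian_induce_subgraph[OF nomulti_digraph, of ?W] by (simp add: n_def)
  have bij: "bij_betw (vertex_at ?H) {0..<n} ?W"
    using bij_betw_vertex_at[of ?H] by (simp add: n_def)
  define \<mu> where "\<mu> = second_smallest_eigenvalue (laplacian ?H)"
  note second = second_smallest_eigenvalue_laplacian[where E = ?E,
      OF bij sym card[folded n_def] path, folded lap \<mu>_def]

  define d where "d = sqrt (real (card S) * real b)"
  have b: "real b = (\<Sum>v\<in>?W. e v)"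
    unfolding b_def e_def card_edge_boundary[OF finite_verts S sym_arcs] by simp
  \<comment> \<open>A non-grounded vertex has at most \<open>\<bar>S\<bar>\<close> and at most \<open>\<bar>\<partial>S\<bar>\<close> grounded neighbours.\<close>
  have ed: "e v \<le> d" if v: "v \<in> ?W" for v
  proof -
    have "e v \<le> card S" unfolding e_def using finS by (auto intro: card_mono)
    moreover have "e v \<le> b"
      unfolding b by (rule member_le_sum[OF v]) (auto simp: e_def)
    ultimately have "(e v)\<^sup>2 \<le> real (card S) * real b"
      unfolding power2_eq_square by (intro mult_mono) (auto simp: e_def)
    thus ?thesis unfolding d_def by (rule real_le_rsqrt)
  qed
  have W: "finite ?W" "?W \<noteq> {}" using \<open>n > 0\<close> unfolding n_def card_gt_0_iff by blast+
  have cW: "real (card ?W) = real (card (verts G)) - real (card S)"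
    using card_Diff_subset[OF finS S] card_mono[OF finite_verts S] by simp
  have e0: "0 \<le> e v" for v by (simp add: e_def)
  have const: "dirichlet_form ?W ?E (\<lambda>_. c) = 0" for c by (simp add: dirichlet_form_def)
  have "t \<le> (\<Sum>v\<in>?W. e v) / card ?W"
    and "(1 - 2 * (d / \<mu>)) * ((\<Sum>v\<in>?W. e v) / card ?W) \<le> t"
    using ground_eigenvalue_bounds[where D = "dirichlet_form ?W ?E", OF W dirichlet_form_nonneg const
        dirichlet_form_shift e0 ed second(2,1) small(1) f] by blast+
  thus "smallest_eigenvalue (grounded_laplacian G S) \<le> \<tau>"
    and "(1 - 2 * \<rho>) * \<tau> \<le> smallest_eigenvalue (grounded_laplacian G S)"
    by (simp_all add: t_def \<rho>_def \<tau>_def d_def \<mu>_def b_def[symmetric] b cW)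
qed

theorem theorem2:
  fixes G :: "nat \<Rightarrow> ('a::linorder, 'b) pre_digraph" and S :: "nat \<Rightarrow> 'a set"
  assumes "\<And>n. n \<ge> 1 \<Longrightarrow> graph (G n)"
    and "\<And>n. n \<ge> 1 \<Longrightarrow> Digraph_Component.connected (G n)"
    and "\<And>n. n \<ge> 1 \<Longrightarrow> card (verts (G n)) = n"
    and "\<And>n. n \<ge> 1 \<Longrightarrow> S n \<noteq> {} \<and> S n \<subseteq> verts (G n)"
    and "\<forall>\<^sub>F n in sequentially.
           Digraph_Component.connected (G n \<restriction> (verts (G n) - S n)) \<and> card (verts (G n) - S n) \<ge> 2"
  shows
    "(limsup (\<lambda>n. ereal (2 * sqrt (real (card (S n)) * real (card (edge_boundary (G n) (S n))))
          / second_smallest_eigenvalue (laplacian (G n \<restriction> (verts (G n) - S n))))) < 1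
      \<longrightarrow> (\<exists>c1 c2 :: real. c1 > 0 \<and> c2 > 0 \<and> (\<forall>\<^sub>F n in sequentially.
            c1 * (real (card (edge_boundary (G n) (S n))) / (real n - real (card (S n))))
              \<le> smallest_eigenvalue (grounded_laplacian (G n) (S n)) \<and>
            smallest_eigenvalue (grounded_laplacian (G n) (S n))
              \<le> c2 * (real (card (edge_boundary (G n) (S n))) / (real n - real (card (S n)))))))
   \<and> ((\<lambda>n. sqrt (real (card (S n)) * real (card (edge_boundary (G n) (S n))))
          / second_smallest_eigenvalue (laplacian (G n \<restriction> (verts (G n) - S n)))) \<longlonglongrightarrow> 0
      \<longrightarrow> (\<exists>\<epsilon> :: nat \<Rightarrow> real. \<epsilon> \<longlonglongrightarrow> 0 \<and> (\<forall>\<^sub>F n in sequentially.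
            (1 - \<epsilon> n) * (real (card (edge_boundary (G n) (S n))) / (real n - real (card (S n))))
              \<le> smallest_eigenvalue (grounded_laplacian (G n) (S n)) \<and>
            smallest_eigenvalue (grounded_laplacian (G n) (S n))
              \<le> real (card (edge_boundary (G n) (S n))) / (real n - real (card (S n))))))"
proof -
  define \<rho> where "\<rho> n = sqrt (real (card (S n)) * real (card (edge_boundary (G n) (S n))))
          / second_smallest_eigenvalue (laplacian (G n \<restriction> (verts (G n) - S n)))" for n
  define \<tau> where "\<tau> n = real (card (edge_boundary (G n) (S n))) / (real n - real (card (S n)))" for n
  define t where "t n = smallest_eigenvalue (grounded_laplacian (G n) (S n))" for n
  have bounds: "\<forall>\<^sub>F n in sequentially. (1 - 2 * \<rho> n) * \<tau> n \<le> t n \<and> t n \<le> \<tau> n"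
    using assms(5) eventually_ge_at_top[of 1]
  proof eventually_elim
    case (elim n)
    thus ?case
      using grounded_laplacian_eigenvalue_bounds[of "G n" "S n"] assms(1,3,4)[of n]
      by (simp add: \<rho>_def \<tau>_def t_def)
  qed
  have \<tau>0: "\<forall>\<^sub>F n in sequentially. 0 \<le> \<tau> n"
    using eventually_ge_at_top[of 1]
  proof eventually_elim
    case (elim n)
    interpret graph "G n" using assms(1) elim .
    have "card (S n) \<le> n" using card_mono[OF finite_verts] assms(3,4) elim by metis
    thus ?case by (simp add: \<tau>_def)
  qed
  have 1: "\<exists>c1 c2 :: real. c1 > 0 \<and> c2 > 0 \<and>
      (\<forall>\<^sub>F n in sequentially. c1 * \<tau> n \<le> t n \<and> t n \<le> c2 * \<tau> n)"
    if ls: "limsup (\<lambda>n. ereal (2 * \<rho> n)) < 1"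
  proof -
    \<comment> \<open>A real \<open>c\<close> strictly between the limit superior and \<open>1\<close> leaves the constant \<open>1 - c\<close>.\<close>
    obtain c where c: "limsup (\<lambda>n. ereal (2 * \<rho> n)) < ereal c" "ereal c < 1"
      using ereal_dense2[OF ls] by blast
    have "\<forall>\<^sub>F n in sequentially. ereal (2 * \<rho> n) < ereal c"
      using Limsup_lessD[OF c(1)] .
    hence "\<forall>\<^sub>F n in sequentially. (1 - c) * \<tau> n \<le> t n \<and> t n \<le> 1 * \<tau> n"
      using bounds \<tau>0
    proof eventually_elim
      case (elim n)
      hence "(1 - c) * \<tau> n \<le> (1 - 2 * \<rho> n) * \<tau> n" by (intro mult_right_mono) auto
      thus ?case using elim by simp
    qed
    moreover have "1 - c > 0" using c(2) by simp
    ultimately show ?thesis by (intro exI[of _ "1 - c"] exI[of _ "1 :: real"]) simp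
  qed
  have 2: "\<exists>\<epsilon> :: nat \<Rightarrow> real. \<epsilon> \<longlonglongrightarrow> 0 \<and>
      (\<forall>\<^sub>F n in sequentially. (1 - \<epsilon> n) * \<tau> n \<le> t n \<and> t n \<le> \<tau> n)"
    if "\<rho> \<longlonglongrightarrow> 0"
    using bounds tendsto_mult_right_zero[OF that, of 2] by (intro exI[of _ "\<lambda>n. 2 * \<rho> n"]) simp
  show ?thesis
    using 1 2 unfolding \<rho>_def[abs_def] \<tau>_def t_def by (simp only: times_divide_eq_right) blast
qed

end
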